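(* Assume that for every integer $u \ge 1$, every sequence $a_0, \dots, a_{v-1}$ with $a_i \in \{-1,1\}$ and $v = 4u^2$ whose periodic autocorrelation satisfies $\theta(0) = v$ and $\theta(t) = 0$ for $t \not\equiv 0 \pmod v$ also has aperiodic autocorrelation satisfying $\rho(t) \in \{0, 1, -1\}$ for all $0 < t < v$. Then the number of cyclic Hadamard matrices (of all orders taken together) is finite.
   Context: For a sequence $a_0, \dots, a_{n-1}$ of real numbers, the periodic autocorrelation is $\theta(t) = \sum_{i=0}^{n-1} a_i a_{i+t}$ (indices taken modulo $n$) and the aperiodic autocorrelation is $\rho(t) = \sum_{i=0}^{n-1-t} a_i a_{i+t}$ for $0 \le t < n$. A cyclic Hadamard matrix of order $n$ is an $n \times n$ matrix $H$ with entries in $\{-1,1\}$ whose rows are the successive cyclic shifts of its first row $(a_0, \dots, a_{n-1})$, and which satisfies $H H^T = n I_n$. *)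

theory Defs
  imports "Jordan_Normal_Form.Matrix" "HOL-Number_Theory.Cong"
begin

text \<open>A sequence \<open>a\<^sub>0, \<dots>, a\<^sub>n\<^sub>-\<^sub>1\<close> is given by its length \<open>n\<close> and a function on the naturals,
  of which only the values below \<open>n\<close> are used.\<close>

definition periodic_autocorrelation :: "nat \<Rightarrow> (nat \<Rightarrow> real) \<Rightarrow> int \<Rightarrow> real" where
  "periodic_autocorrelation n a t = (\<Sum>i<n. a i * a (nat ((int i + t) mod int n)))"

text \<open>Only meant for \<open>t < n\<close>; the indices \<open>i < n - t\<close> are then exactly \<open>0, \<dots>, n - 1 - t\<close>.\<close>

definition aperiodic_autocorrelation :: "nat \<Rightarrow> (nat \<Rightarrow> real) \<Rightarrow> nat \<Rightarrow> real" where
  "aperiodic_autocorrelation n a t = (\<Sum>i<n - t. a i * a (i + t))"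

text \<open>Row \<open>i\<close> is the first row shifted cyclically \<open>i\<close> places to the right (the usual
  circulant convention); \<open>j + n - i\<close> represents \<open>j - i\<close> modulo \<open>n\<close> without truncation.\<close>

definition cyclic_hadamard :: "nat \<Rightarrow> real mat \<Rightarrow> bool" where
  "cyclic_hadamard n H \<longleftrightarrow>
     n \<ge> 1 \<and> H \<in> carrier_mat n n \<and>
     (\<forall>i<n. \<forall>j<n. H $$ (i, j) \<in> {-1, 1}) \<and>
     (\<forall>i<n. \<forall>j<n. H $$ (i, j) = H $$ (0, (j + n - i) mod n)) \<and>
     H * transpose_mat H = real n \<cdot>\<^sub>m 1\<^sub>m n"

end

theory Submission
  imports Defs "HOL-Library.FuncSet"
begin

text \<open>Every cyclic shift of a perfect sequence \<open>A\<close> of period \<open>n\<close> is again perfect, so under the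
  hypothesis all shifts have aperiodic autocorrelations in \<open>{0, 1, -1}\<close>. Put \<open>b k = A k * A (k + 2)\<close>.
  The aperiodic autocorrelation of a shift at \<open>2\<close> is \<open>-(b k + b (k + 1))\<close> for a suitable \<open>k\<close>, because
  the periodic one vanishes; being even, it is \<open>0\<close>. Hence \<open>b (k + 1) = - b k\<close> for all \<open>k\<close>, and
  \<open>A k * A (k + 4) = b k * b (k + 2) = 1\<close>, so the periodic autocorrelation at \<open>4\<close> is \<open>n\<close>, which is
  impossible for \<open>n > 4\<close>. The first row of a cyclic Hadamard matrix of order \<open>n > 1\<close> is perfect, and
  \<open>n = 4u\<^sup>2\<close> since \<open>n\<close> is even and is the square of the row sum.\<close>

lemma periodic_int_mod:
  fixes f :: "int \<Rightarrow> 'a"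
  assumes per: "\<And>k. f (k + N) = f k"
  shows "f (k mod N) = f k"
proof -
  have mult: "f (k + m * N) = f k" for k m
  proof (induction m rule: int_induct[where k = 0])
    case base
    then show ?case by simp
  next
    case (step1 i)
    then show ?case using per[of "k + i * N"] by (simp add: algebra_simps)
  next
    case (step2 i)
    then show ?case using per[of "k + (i - 1) * N"] by (simp add: algebra_simps)
  qed
  show ?thesis
    using mult[of "k mod N" "k div N"] by simp
qed

text \<open>Passing from \<open>s\<close> to \<open>s + 1\<close> drops the first term
  \<open>f s\<close> and appends the equal term \<open>f (s + n)\<close>; induction in both
  directions reaches every integer \<open>s\<close>.\<close>

lemma sum_periodic_shift:
  fixes f :: "int \<Rightarrow> 'a::ab_group_add"
  assumes per: "\<And>k. f (k + int n) = f k"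
  shows "(\<Sum>i<n. f (int i + s)) = (\<Sum>i<n. f (int i))"
proof -
  have step: "(\<Sum>i<n. f (int i + (s + 1))) = (\<Sum>i<n. f (int i + s))" for s
  proof -
    have "f s + (\<Sum>i<n. f (int i + (s + 1))) = (\<Sum>i<Suc n. f (int i + s))"
      by (simp only: sum.lessThan_Suc_shift) (simp add: algebra_simps)
    also have "\<dots> = (\<Sum>i<n. f (int i + s)) + f s"
      using per[of s] by (simp add: algebra_simps)
    finally show ?thesis by (simp add: algebra_simps)
  qed
  show ?thesis
  proof (induction s rule: int_induct[where k = 0])
    case base
    then show ?case by simp
  next
    case (step1 i)
    then show ?case using step[of i] by simp
  next
    case (step2 i)
    then show ?case using step[of "i - 1"] by simp
  qed
qed

text \<open>Here \<open>q\<close> counts the terms equal to 1, so the sum is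
  \<open>q - (card I - q)\<close> and has the parity of the number of terms.\<close>

lemma sum_signs_parity:
  fixes f :: "'a \<Rightarrow> real"
  assumes "finite I" and "\<And>i. i \<in> I \<Longrightarrow> f i \<in> {-1, 1}"
  shows "\<exists>q::int. sum f I = of_int (2 * q - int (card I))"
  using assms
proof (induction I rule: finite_induct)
  case empty
  show ?case by (rule exI[of _ 0]) simp
next
  case (insert x F)
  then obtain q where q: "sum f F = of_int (2 * q - int (card F))" by auto
  have "f x = -1 \<or> f x = 1" using insert.prems by auto
  then show ?case
  proof
    assume "f x = -1"
    then show ?thesis using insert q by (intro exI[of _ q]) simp
  next
    assume "f x = 1"
    then show ?thesis using insert q by (intro exI[of _ "q + 1"]) simp
  qed
qed

text \<open>Extending the sequence periodically to all integers turns cyclic shifts into plain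
  translations, with no reduction of indices modulo \<open>n\<close>.\<close>

locale perfect_sequence =
  fixes n :: nat and A :: "int \<Rightarrow> real"
  assumes pos: "n \<ge> 1"
    and per: "A (k + int n) = A k"
    and sgn: "A k \<in> {-1, 1}"
    and perfect: "\<not> [t = 0] (mod int n) \<Longrightarrow> (\<Sum>i<n. A (int i) * A (int i + t)) = 0"
begin

lemma product_cases: "A k * A l = -1 \<or> A k * A l = 1"
  using sgn[of k] sgn[of l] by auto

lemma square_eq_1 [simp]: "A k * A k = 1"
  using sgn[of k] by auto

lemma periodic_autocorrelation_shift:
  "periodic_autocorrelation n (\<lambda>i. A (int i + s)) t = (\<Sum>i<n. A (int i) * A (int i + t))"
proof -
  have "A (int (nat ((int i + t) mod int n)) + s) = A (int i + s + t)" for i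
  proof -
    have "A ((int i + t) mod int n + s) = A (((int i + t) mod int n + s) mod int n)"
      by (rule periodic_int_mod[where f = A, OF per, symmetric])
    also have "\<dots> = A ((int i + s + t) mod int n)"
      by (simp add: mod_simps algebra_simps)
    also have "\<dots> = A (int i + s + t)"
      by (rule periodic_int_mod[where f = A, OF per])
    finally show ?thesis using pos by simp
  qed
  then have "periodic_autocorrelation n (\<lambda>i. A (int i + s)) t
      = (\<Sum>i<n. A (int i + s) * A (int i + s + t))"
    by (simp only: periodic_autocorrelation_def)
  also have "\<dots> = (\<Sum>i<n. A (int i) * A (int i + t))"
  proof (rule sum_periodic_shift)
    fix k
    show "A (k + int n) * A (k + int n + t) = A k * A (k + t)"
      using per[of k] per[of "k + t"] by (simp add: ac_simps)
  qed
  finally show ?thesis .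
qed

lemma even_length:
  assumes "n > 1"
  shows "even n"
proof -
  have "\<not> [1 = 0] (mod int n)"
    using assms by (simp add: cong_def)
  then have "(\<Sum>i<n. A (int i) * A (int i + 1)) = 0"
    by (rule perfect)
  moreover obtain q where "(\<Sum>i<n. A (int i) * A (int i + 1)) = of_int (2 * q - int n)"
    using sum_signs_parity[of "{..<n}" "\<lambda>i. A (int i) * A (int i + 1)"] product_cases by auto
  ultimately have "int n = 2 * q" by linarith
  then show ?thesis by presburger
qed

text \<open>Grouping the products of the expanded square by the difference of their indices gives
  the sum of all periodic autocorrelations, of which only the one at 0 survives.\<close>

lemma square_of_sum: "(\<Sum>i<n. A (int i))\<^sup>2 = real n"
proof -
  have "(\<Sum>i<n. A (int i))\<^sup>2 = (\<Sum>i<n. A (int i) * (\<Sum>t<n. A (int t)))"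
    by (simp add: power2_eq_square sum_distrib_right)
  also have "\<dots> = (\<Sum>i<n. A (int i) * (\<Sum>t<n. A (int t + int i)))"
    by (simp only: sum_periodic_shift[where f = A, OF per])
  also have "\<dots> = (\<Sum>i<n. \<Sum>t<n. A (int i) * A (int i + int t))"
    by (simp add: sum_distrib_left add.commute)
  also have "\<dots> = (\<Sum>t<n. \<Sum>i<n. A (int i) * A (int i + int t))"
    by (rule sum.swap)
  also have "\<dots> = (\<Sum>t<n. if t = 0 then real n else 0)"
    by (intro sum.cong refl) (auto simp: cong_def intro!: perfect)
  also have "\<dots> = real n"
    using pos by simp
  finally show ?thesis .
qed

text \<open>As \<open>n\<close> is even, parity makes the sum of the sequence even too; its square
  is \<open>n\<close>, so \<open>u\<close> is half its absolute value.\<close>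

lemma length_eq_four_square:
  assumes "n > 1"
  obtains u where "u \<ge> 1" and "n = 4 * u\<^sup>2"
proof -
  obtain k where k: "n = 2 * k" using even_length[OF assms] by (elim evenE)
  obtain q where "(\<Sum>i<n. A (int i)) = of_int (2 * q - int n)"
    using sum_signs_parity[of "{..<n}" "\<lambda>i. A (int i)"] sgn by auto
  then have "real_of_int ((2 * q - int n)\<^sup>2) = of_int (int n)"
    using square_of_sum by simp
  then have "(2 * q - int n)\<^sup>2 = int n"
    by (simp only: of_int_eq_iff)
  then have "4 * (q - int k)\<^sup>2 = int n"
    unfolding k by (simp add: power2_eq_square algebra_simps)
  then have "int n = int (4 * (nat \<bar>q - int k\<bar>)\<^sup>2)"
    by simp
  then have *: "n = 4 * (nat \<bar>q - int k\<bar>)\<^sup>2"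
    by (simp only: of_nat_eq_iff)
  moreover have "nat \<bar>q - int k\<bar> \<ge> 1"
    using * assms by (cases "nat \<bar>q - int k\<bar>") auto
  ultimately show ?thesis using that by blast
qed

lemma length_le_4:
  assumes barker: "\<And>s. n > 2 \<Longrightarrow> aperiodic_autocorrelation n (\<lambda>i. A (int i + s)) 2 \<in> {0, 1, -1}"
  shows "n \<le> 4"
proof (rule ccontr)
  assume "\<not> n \<le> 4"
  then obtain m where m: "n = Suc (Suc m)" "m > 2"
    using that[of "n - 2"] by linarith
  define b where "b k = A k * A (k + 2)" for k
  have b: "b (k + 1) = - b k" for k
  proof -
    \<comment> \<open>With this \<open>s\<close> the indices \<open>i = m\<close> and
      \<open>i = m + 1\<close> contribute \<open>b k\<close> and \<open>b (k + 1)\<close>. These are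
      the two wrap-around terms that the aperiodic sum at 2 leaves out.\<close>
    define s where "s = k - int m"
    have "\<not> [2 = 0] (mod int n)"
      using m by (simp add: cong_def)
    then have "(\<Sum>i<n. A (int i) * A (int i + 2)) = 0"
      by (rule perfect)
    moreover have "b (j + int n) = b j" for j
      using per[of j] per[of "j + 2"] by (simp add: b_def ac_simps)
    ultimately have "(\<Sum>i<n. b (int i + s)) = 0"
      using sum_periodic_shift[of b n s] by (simp add: b_def)
    moreover have "(\<Sum>i<n. b (int i + s))
        = aperiodic_autocorrelation n (\<lambda>i. A (int i + s)) 2 + b k + b (k + 1)"
      by (simp add: m aperiodic_autocorrelation_def b_def s_def algebra_simps)
    ultimately have "b k + b (k + 1) \<in> {0, 1, -1}"
      using barker[of s] m by auto
    moreover have "b k = -1 \<or> b k = 1" "b (k + 1) = -1 \<or> b (k + 1) = 1"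
      unfolding b_def by (rule product_cases)+
    ultimately show ?thesis by auto
  qed
  have "A k * A (k + 4) = 1" for k
  proof -
    \<comment> \<open>The inserted square is 1 and supplies the factor \<open>A (k + 2)\<close> that
      both \<open>b k\<close> and \<open>b (k + 2)\<close> contain.\<close>
    have "A k * A (k + 4) = (A k * A (k + 4)) * (A (k + 2) * A (k + 2))"
      by simp
    also have "\<dots> = b k * b (k + 2)"
      by (simp only: b_def add.assoc) (simp add: algebra_simps)
    also have "b (k + 2) = b k"
      using b[of k] b[of "k + 1"] by (simp add: add.assoc)
    also have "b k * b k = 1"
      unfolding b_def using product_cases[of k "k + 2"] by auto
    finally show ?thesis .
  qed
  then have "(\<Sum>i<n. A (int i) * A (int i + 4)) = real n"
    by simp
  moreover have "\<not> [4 = 0] (mod int n)"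
    using \<open>\<not> n \<le> 4\<close> by (simp add: cong_def)
  ultimately show False
    using perfect[of 4] pos by simp
qed

end

text \<open>The inner product of rows 0 and \<open>i\<close> is the periodic autocorrelation of the
  first row at \<open>-i\<close>, so orthogonality of the rows is perfection of the
  sequence.\<close>

lemma cyclic_hadamard_perfect_sequence:
  assumes "cyclic_hadamard n H"
  shows "perfect_sequence n (\<lambda>k. H $$ (0, nat (k mod int n)))"
proof -
  define A where "A k = H $$ (0, nat (k mod int n))" for k
  from assms have n: "n \<ge> 1" and H: "H \<in> carrier_mat n n"
    and signs: "\<And>i j. i < n \<Longrightarrow> j < n \<Longrightarrow> H $$ (i, j) \<in> {-1, 1}"
    and circ: "\<And>i j. i < n \<Longrightarrow> j < n \<Longrightarrow> H $$ (i, j) = H $$ (0, (j + n - i) mod n)"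
    and orth: "H * transpose_mat H = real n \<cdot>\<^sub>m 1\<^sub>m n"
    unfolding cyclic_hadamard_def by blast+
  have entry: "H $$ (i, j) = A (int j - int i)" if "i < n" "j < n" for i j
  proof -
    have "int ((j + n - i) mod n) = (int j - int i + int n) mod int n"
      using that by (simp add: zmod_int of_nat_diff algebra_simps)
    then have "(j + n - i) mod n = nat ((int j - int i) mod int n)"
      by (metis mod_add_self2 nat_int)
    then show ?thesis using circ[OF that] by (simp add: A_def)
  qed
  have per: "A (k + int n) = A k" for k
    by (simp add: A_def)
  have sgn: "A k \<in> {-1, 1}" for k
    unfolding A_def using n by (intro signs) (auto simp: nat_less_iff)
  have "(\<Sum>j<n. A (int j) * A (int j + t)) = 0" if t: "\<not> [t = 0] (mod int n)" for t
  proof -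
    \<comment> \<open>Row \<open>i\<close> has entries \<open>A (j - i)\<close>, so this choice
      makes it the translate by \<open>t\<close>.\<close>
    define i where "i = nat ((- t) mod int n)"
    have i: "int i = (- t) mod int n" "i < n"
      using n by (auto simp: i_def nat_less_iff)
    have "i \<noteq> 0"
      using t i by (metis cong_0_iff dvd_eq_mod_eq_0 dvd_minus_iff of_nat_0)
    have shift: "A (int j - int i) = A (int j + t)" for j
      by (simp add: A_def i mod_simps)
    have "(H * transpose_mat H) $$ (0, i) = (\<Sum>j<n. H $$ (0, j) * H $$ (i, j))"
      using H i n by (simp add: scalar_prod_def lessThan_atLeast0)
    also have "\<dots> = (\<Sum>j<n. A (int j) * A (int j + t))"
      using i(2) n by (intro sum.cong) (simp_all add: entry shift)
    finally show ?thesis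
      using orth i \<open>i \<noteq> 0\<close> n by simp
  qed
  then show ?thesis
    using n per sgn unfolding perfect_sequence_def A_def by blast
qed

lemma finite_mat_entries:
  assumes "finite S"
  shows "finite {M. M \<in> carrier_mat m n \<and> (\<forall>i<m. \<forall>j<n. M $$ (i, j) \<in> S)}"
proof (rule finite_subset)
  let ?I = "{..<m} \<times> {..<n}"
  show "finite (mat m n ` (?I \<rightarrow>\<^sub>E S))"
    using assms by (intro finite_imageI finite_PiE) auto
  show "{M. M \<in> carrier_mat m n \<and> (\<forall>i<m. \<forall>j<n. M $$ (i, j) \<in> S)} \<subseteq> mat m n ` (?I \<rightarrow>\<^sub>E S)"
  proof
    fix M assume "M \<in> {M. M \<in> carrier_mat m n \<and> (\<forall>i<m. \<forall>j<n. M $$ (i, j) \<in> S)}"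
    then show "M \<in> mat m n ` (?I \<rightarrow>\<^sub>E S)"
      \<comment> \<open>Restricting the entry function to the index range places it in the
        extensional function space, which is finite.\<close>
      by (intro image_eqI[of _ _ "restrict (($$) M) ?I"] eq_matI) auto
  qed
qed

theorem theorem25:
  assumes "\<And>(u::nat) (v::nat) (a::nat \<Rightarrow> real).
      u \<ge> 1 \<Longrightarrow> v = 4 * u\<^sup>2 \<Longrightarrow>
      (\<forall>i<v. a i \<in> {-1, 1}) \<Longrightarrow>
      periodic_autocorrelation v a 0 = real v \<Longrightarrow>
      (\<forall>t. \<not> [t = 0] (mod int v) \<longrightarrow> periodic_autocorrelation v a t = 0) \<Longrightarrow>
      (\<forall>t. 0 < t \<and> t < v \<longrightarrow> aperiodic_autocorrelation v a t \<in> {0, 1, -1})"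
  shows "finite {H. \<exists>n. cyclic_hadamard n H}"
proof (rule finite_subset)
  let ?M = "\<lambda>n. {H. H \<in> carrier_mat n n \<and> (\<forall>i<n. \<forall>j<n. H $$ (i, j) \<in> {-1, 1::real})}"
  show "finite (\<Union>n\<le>4. ?M n)"
    by (intro finite_UN_I finite_mat_entries) auto
  have "n \<le> 4" if H: "cyclic_hadamard n H" for n H
  proof -
    define A where "A k = H $$ (0, nat (k mod int n))" for k
    interpret perfect_sequence n A
      using cyclic_hadamard_perfect_sequence[OF H] unfolding A_def .
    show ?thesis
    proof (rule length_le_4)
      fix s assume "n > 2"
      then obtain u where u: "u \<ge> 1" "n = 4 * u\<^sup>2"
        using length_eq_four_square by auto
      \<comment> \<open>Shifting preserves the periodic autocorrelations, so the hypothesis applies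
        to each shift separately. The aperiodic ones may depend on \<open>s\<close>, and
        \<open>length_le_4\<close> asks for all of them.\<close>
      have "\<forall>t. 0 < t \<and> t < n \<longrightarrow>
          aperiodic_autocorrelation n (\<lambda>i. A (int i + s)) t \<in> {0, 1, -1}"
        by (rule assms[OF u])
          (use sgn perfect in \<open>simp_all only: periodic_autocorrelation_shift, simp_all\<close>)
      then show "aperiodic_autocorrelation n (\<lambda>i. A (int i + s)) 2 \<in> {0, 1, -1}"
        using \<open>n > 2\<close> by auto
    qed
  qed
  then show "{H. \<exists>n. cyclic_hadamard n H} \<subseteq> (\<Union>n\<le>4. ?M n)"
    unfolding cyclic_hadamard_def by blast
qed

end
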